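(* Let $F=(f_1,\dots,f_k):\mathbb{R}^n\to\mathbb{R}^k$ be continuous with continuously differentiable components, let $Q\subset\mathbb{R}^n$ be compact, let $\epsilon\in\mathbb{R}^k_+$ and $\Delta^*,\Delta\in\mathbb{R}_+$ with $\Delta^*<\Delta$. Consider the multi-objective optimization problem $\min_{x\in Q}F(x)$. Let $(P_l)_{l\in\mathbb{N}}$ be the random candidate sets produced by the generic stochastic search algorithm, and assume $$\forall x\in Q\ \text{and}\ \forall\delta>0:\quad \mathbb{P}\left(\exists l\in\mathbb{N}:\ P_l\cap B_\delta(x)\cap Q\neq\emptyset\right)=1 .$$ Assume further: (A1) there is no weak Pareto point in $Q\setminus P_Q$; (A2) there is no $-\epsilon$ weak Pareto point in $Q\setminus\overline{P_{Q,\epsilon}}$; (A3) with $\mathcal{B}:=\{x\in Q\mid \exists y\in P_Q:\ F(y)+\epsilon=F(x)\}$, one has $\mathcal{B}\subset\overset{\circ}{Q}$ and $q(x)\neq0$ for all $x\in\mathcal{B}$. Let $A_l$, $l\in\mathbb{N}$, be the archives produced by the generic stochastic search algorithm with $\mathit{ArchiveUpdateP}_{Q,\epsilon}(P,A,\Delta)$ used to update the archive. Let $m_i=\min_{x\in Q}f_i(x)$ and $M_i=\max_{x\in Q}f_i(x)$ for $1\le i\le k$. Let $l_0\in\mathbb{N}$ (which exists with probability one) be such that for all $l\ge l_0$: (b1) $\mathrm{dist}(F(P_{Q,\epsilon}),F(A_l))<\Delta$, (b2) $\mathrm{dist}(F(A_l),F(P_{Q,\epsilon}))\le\mathrm{dist}(F(P_{Q,\epsilon+2\Delta}),F(P_{Q,\epsilon}))$,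 (b3) $d_H(F(P_{Q,\epsilon}),F(A_l))\le \max\big(\Delta,\ \mathrm{dist}(F(P_{Q,\epsilon+2\Delta}),F(P_{Q,\epsilon}))\big)$. Then for all $l\ge l_0$ the archive size is bounded by $$|A_l|\le\left(\frac{1}{\Delta^*}\right)^k\sum_{i=1}^k(\epsilon_i+2\Delta+\Delta^* )\prod_{\substack{j=1\\ j\neq i}}^k(M_j-m_j+\Delta^* ).$$
   Context: $\mathbb{R}_+$ denotes the positive reals and $\mathbb{R}^k_+$ the vectors with all components positive. For $v,w\in\mathbb{R}^k$, $v<_pw$ (resp. $v\leq_pw$) means $v_i<w_i$ (resp. $v_i\le w_i$) for all $i$. $x\prec y$ ($x$ dominates $y$) means $F(x)\leq_pF(y)$ and $F(x)\ne F(y)$. For $\epsilon\in\mathbb{R}^k_+$, $x\prec_{-\epsilon}y$ ($x$ $-\epsilon$-dominates $y$) means $F(x)+\epsilon\leq_pF(y)$ and $F(x)+\epsilon\neq F(y)$. The Pareto set $P_Q$ is the set of $x\in Q$ such that no $y\in Q$ satisfies $y\prec x$. $P_{Q,\epsilon}:=\{x\in Q\mid\not\exists y\in Q:\ y\prec_{-\epsilon}x\}$. $1\Delta:=(\Delta,\dots,\Delta)\in\mathbb{R}^k_+$, and $P_{Q,\epsilon+2\Delta}$ means $P_{Q,\epsilon'}$ with $\epsilon'=\epsilon+2\cdot1\Delta$. A point $x\in Q$ is a weak Pareto point if there is no $y\in Q$ with $F(y)<_pF(x)$; it is a $-\epsilon$ weak Pareto point if there is no $y\in Q$ with $F(y)+\epsilon<_pF(x)$.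 $q(x):=\sum_{i=1}^k\hat\alpha_i\nabla f_i(x)$, where $\hat\alpha$ is a solution of $\min_{\alpha\in\mathbb{R}^k}\{\|\sum_{i=1}^k\alpha_i\nabla f_i(x)\|_2^2:\ \alpha_i\ge0,\ i=1,\dots,k,\ \sum_{i=1}^k\alpha_i=1\}$. $\overline{A}$ and $\overset{\circ}{A}$ denote closure and interior; $B_\delta(x)$ is the open ball of radius $\delta$ about $x$. For a point $u$ and sets $A,B$: $\mathrm{dist}(u,A):=\inf_{v\in A}\|u-v\|$, $\mathrm{dist}(B,A):=\sup_{u\in B}\mathrm{dist}(u,A)$, $d_H(A,B):=\max\{\mathrm{dist}(A,B),\mathrm{dist}(B,A)\}$; in image space $\mathbb{R}^k$ the norm used is $\|\cdot\|_\infty$, and $d_\infty(u,v)=\|u-v\|_\infty$. Generic stochastic search algorithm: $P_0\subset Q$ is drawn at random and $A_0=\mathit{ArchiveUpdate}(P_0,\emptyset)$; for $j=0,1,2,\dots$, $P_{j+1}=\mathit{Generate}(P_j)\subset Q$ (a random generation process) and $A_{j+1}=\mathit{ArchiveUpdate}(P_{j+1},A_j)$. All $P_j$ are finite sets. Procedure $\mathit{ArchiveUpdateP}_{Q,\epsilon}(P,A_{\mathrm{in}},\Delta)$, with parameters $\epsilon$, $\Delta$ and $\Delta^*\in(0,\Delta)$: set $A:=A_{\mathrm{in}}$. Process the elements $p\in P$ one after another (in any order). For each $p$: if there is no $a_1\in A$ with $a_1\prec_{-\epsilon}p$ and there is no $a_2\in A$ with $d_\infty(F(a_2),F(p))\le\Delta^*$,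 then set $A:=A\cup\{p\}$ and afterwards remove from $A$ every $a\in A$ with $p\prec_{-(\epsilon+1\Delta)}a$; otherwise leave $A$ unchanged. Return $A$. *)

theory Defs
  imports "HOL-Probability.Probability"
begin

text \<open>
  On \<^typ>\<open>real ^ 'k\<close> the library order \<open>\<le>\<close> is the componentwise one, i.e. \<open>\<le>\<^sub>p\<close>; the library's
  \<open><\<close> is however not componentwise strict, whence a separate \<open><\<^sub>p\<close>.
\<close>

definition less_p :: "real ^ 'k \<Rightarrow> real ^ 'k \<Rightarrow> bool"  (infix \<open><\<^sub>p\<close> 50)
  where "v <\<^sub>p w \<longleftrightarrow> (\<forall>i. v $ i < w $ i)"

definition dominates :: "('s \<Rightarrow> real ^ 'k) \<Rightarrow> 's \<Rightarrow> 's \<Rightarrow> bool"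
  where "dominates F x y \<longleftrightarrow> F x \<le> F y \<and> F x \<noteq> F y"

definition eps_dominates :: "('s \<Rightarrow> real ^ 'k) \<Rightarrow> real ^ 'k \<Rightarrow> 's \<Rightarrow> 's \<Rightarrow> bool"
  where "eps_dominates F \<epsilon> x y \<longleftrightarrow> F x + \<epsilon> \<le> F y \<and> F x + \<epsilon> \<noteq> F y"

definition pareto_set :: "('s \<Rightarrow> real ^ 'k) \<Rightarrow> 's set \<Rightarrow> 's set"
  where "pareto_set F Q = {x \<in> Q. \<not> (\<exists>y\<in>Q. dominates F y x)}"

definition eps_pareto_set :: "('s \<Rightarrow> real ^ 'k) \<Rightarrow> 's set \<Rightarrow> real ^ 'k \<Rightarrow> 's set"
  where "eps_pareto_set F Q \<epsilon> = {x \<in> Q. \<not> (\<exists>y\<in>Q. eps_dominates F \<epsilon> y x)}"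

definition weak_pareto :: "('s \<Rightarrow> real ^ 'k) \<Rightarrow> 's set \<Rightarrow> 's \<Rightarrow> bool"
  where "weak_pareto F Q x \<longleftrightarrow> x \<in> Q \<and> \<not> (\<exists>y\<in>Q. F y <\<^sub>p F x)"

definition eps_weak_pareto :: "('s \<Rightarrow> real ^ 'k) \<Rightarrow> 's set \<Rightarrow> real ^ 'k \<Rightarrow> 's \<Rightarrow> bool"
  where "eps_weak_pareto F Q \<epsilon> x \<longleftrightarrow> x \<in> Q \<and> \<not> (\<exists>y\<in>Q. F y + \<epsilon> <\<^sub>p F x)"

text \<open>
  The vector \<open>q(x)\<close>, as a function of the gradients \<open>g i = \<nabla>f\<^sub>i(x)\<close>. The minimiser \<open>\<alpha>\<close> need not be
  unique, but \<open>q(x)\<close> is: it is the point of least norm in the convex hull of the gradients.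
\<close>

definition min_weights :: "('k \<Rightarrow> 'v::real_normed_vector) \<Rightarrow> real ^ 'k"
  where "min_weights g = arg_min (\<lambda>\<alpha>. (norm (\<Sum>i\<in>UNIV. \<alpha> $ i *\<^sub>R g i))\<^sup>2)
                                 (\<lambda>\<alpha>. (\<forall>i. \<alpha> $ i \<ge> 0) \<and> (\<Sum>i\<in>UNIV. \<alpha> $ i) = 1)"

definition qvec :: "('k::finite \<Rightarrow> 'v::real_normed_vector) \<Rightarrow> 'v"
  where "qvec g = (\<Sum>i\<in>UNIV. min_weights g $ i *\<^sub>R g i)"

definition d_inf :: "real ^ 'k \<Rightarrow> real ^ 'k \<Rightarrow> real"
  where "d_inf u v = infnorm (u - v)"

text \<open>
  Distances of sets take values in \<^typ>\<open>ennreal\<close>, so that the infimum over the empty set is \<open>\<infinity>\<close> and the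
  supremum over the empty set is \<open>0\<close>.
\<close>

definition set_dist :: "(real ^ 'k) set \<Rightarrow> (real ^ 'k) set \<Rightarrow> ennreal"
  where "set_dist B A = (SUP u\<in>B. INF v\<in>A. ennreal (d_inf u v))"

definition hausdorff_dist :: "(real ^ 'k) set \<Rightarrow> (real ^ 'k) set \<Rightarrow> ennreal"
  where "hausdorff_dist A B = max (set_dist A B) (set_dist B A)"

definition archive_step ::
    "('s \<Rightarrow> real ^ 'k) \<Rightarrow> real ^ 'k \<Rightarrow> real \<Rightarrow> real \<Rightarrow> 's \<Rightarrow> 's set \<Rightarrow> 's set"
  where "archive_step F \<epsilon> \<Delta> \<Delta>s p A =
    (if \<not> (\<exists>a\<^sub>1\<in>A. eps_dominates F \<epsilon> a\<^sub>1 p) \<and> \<not> (\<exists>a\<^sub>2\<in>A. d_inf (F a\<^sub>2) (F p) \<le> \<Delta>s)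
     then {a \<in> A \<union> {p}. \<not> eps_dominates F (\<epsilon> + vec \<Delta>) p a}
     else A)"

text \<open>
  A relation rather than a function, since the elements of \<open>P\<close> may be processed in any order;
  \<open>ps\<close> is the order chosen.
\<close>

definition archive_updateP ::
    "('s \<Rightarrow> real ^ 'k) \<Rightarrow> real ^ 'k \<Rightarrow> real \<Rightarrow> real \<Rightarrow> 's set \<Rightarrow> 's set \<Rightarrow> 's set \<Rightarrow> bool"
  where "archive_updateP F \<epsilon> \<Delta> \<Delta>s P A\<^sub>i\<^sub>n A\<^sub>o\<^sub>u\<^sub>t \<longleftrightarrow>
    (\<exists>ps. distinct ps \<and> set ps = P \<and> A\<^sub>o\<^sub>u\<^sub>t = fold (archive_step F \<epsilon> \<Delta> \<Delta>s) ps A\<^sub>i\<^sub>n)"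

text \<open>
  One realisation of the generic stochastic search algorithm: \<open>Gen j\<close> is the outcome of the random
  generation process in step \<open>j\<close>, and \<open>Upd P A A'\<close> says that updating \<open>A\<close> by \<open>P\<close> may give \<open>A'\<close>.
\<close>

definition search_run ::
    "'s set \<Rightarrow> ('s set \<Rightarrow> 's set \<Rightarrow> 's set \<Rightarrow> bool) \<Rightarrow> (nat \<Rightarrow> 's set \<Rightarrow> 's set)
      \<Rightarrow> (nat \<Rightarrow> 's set) \<Rightarrow> (nat \<Rightarrow> 's set) \<Rightarrow> bool"
  where "search_run Q Upd Gen P A \<longleftrightarrow>
    (\<forall>j. finite (P j) \<and> P j \<subseteq> Q) \<and>
    Upd (P 0) {} (A 0) \<and>
    (\<forall>j. P (Suc j) = Gen j (P j) \<and> Upd (P (Suc j)) (A j) (A (Suc j)))"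

text \<open>The three conditions imposed on the archive \<open>A\<close> from the index \<open>l\<^sub>0\<close> on.\<close>

definition archive_close ::
    "('s \<Rightarrow> real ^ 'k) \<Rightarrow> 's set \<Rightarrow> real ^ 'k \<Rightarrow> real \<Rightarrow> 's set \<Rightarrow> bool"
  where "archive_close F Q \<epsilon> \<Delta> A \<longleftrightarrow>
    (let E = F ` eps_pareto_set F Q \<epsilon>;
         E' = F ` eps_pareto_set F Q (\<epsilon> + 2 *\<^sub>R vec \<Delta>)
     in set_dist E (F ` A) < ennreal \<Delta> \<and>
        set_dist (F ` A) E \<le> set_dist E' E \<and>
        hausdorff_dist E (F ` A) \<le> max (ennreal \<Delta>) (set_dist E' E))"

end

theory Submission
  imports Defs
begin

text \<open>
  Almost surely the candidates are dense in \<open>Q\<close>. By (A3), arbitrarily near the image of any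
  \<open>x \<in> P\<^bsub>Q,\<epsilon>\<^esub>\<close> there are images of an open set of points that nothing in \<open>Q\<close>
  \<open>-\<epsilon>\<close>-dominates; once such a point is visited, the archive contains an element whose image
  is within slightly more than \<open>\<Delta>s\<close> of \<open>F x\<close>, and no element closer than \<open>\<Delta>\<close> to \<open>F x\<close> is ever
  removed. A finite net of \<open>F(P\<^bsub>Q,\<epsilon>\<^esub>)\<close> makes this uniform, which is (b1). Given (b1), an archive
  element outside \<open>P\<^bsub>Q,\<epsilon>+2\<Delta>\<^esub>\<close> would be \<open>-(\<epsilon> + vec \<Delta>)\<close>-dominated by another archive element,
  which the update rule never allows; so the archive lies in \<open>P\<^bsub>Q,\<epsilon>+2\<Delta>\<^esub>\<close>, and (b2), (b3) follow.
\<close>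

section \<open>Distances of points and of sets in the maximum norm\<close>

lemma d_inf_commute: "d_inf u v = d_inf v u"
  unfolding d_inf_def by (metis infnorm_neg minus_diff_eq)

lemma d_inf_triangle: "d_inf u w \<le> d_inf u v + d_inf v w"
  unfolding d_inf_def using infnorm_triangle[of "u - v" "v - w"] by simp

lemma d_inf_le_dist: "d_inf u v \<le> dist u v"
  unfolding d_inf_def dist_norm by (rule infnorm_le_norm)

lemma d_inf_self [simp]: "d_inf u u = 0"
  unfolding d_inf_def by (simp add: infnorm_0)

lemma abs_component_le_d_inf: "\<bar>u $ i - v $ i\<bar> \<le> d_inf u v"
  unfolding d_inf_def using component_le_infnorm_cart[of "u - v" i] by simp

text \<open>The index type is finite, so the supremum defining the norm is a maximum. A lower bound
  on \<open>d_inf\<close> thereby becomes a lower bound in one coordinate.\<close>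

lemma d_inf_attained: "\<exists>i. d_inf u v = \<bar>u $ i - v $ i\<bar>"
proof -
  have "d_inf u v = Sup (range (\<lambda>i. \<bar>(u - v) $ i\<bar>))"
    unfolding d_inf_def infnorm_cart by (simp add: full_SetCompr_eq)
  also have "\<dots> = Max (range (\<lambda>i. \<bar>(u - v) $ i\<bar>))"
    by (rule cSup_eq_Max) auto
  also have "\<dots> \<in> range (\<lambda>i. \<bar>(u - v) $ i\<bar>)"
    by (rule Max_in) auto
  finally show ?thesis by auto
qed

lemma set_dist_mono: "B \<subseteq> C \<Longrightarrow> set_dist B A \<le> set_dist C A"
  unfolding set_dist_def by (rule SUP_subset_mono) auto

lemma set_dist_le:
  assumes "\<And>u. u \<in> B \<Longrightarrow> \<exists>v\<in>A. d_inf u v \<le> r"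
  shows "set_dist B A \<le> ennreal r"
  unfolding set_dist_def
proof (rule SUP_least)
  fix u assume "u \<in> B"
  then obtain v where "v \<in> A" "d_inf u v \<le> r" using assms by blast
  then show "(INF v\<in>A. ennreal (d_inf u v)) \<le> ennreal r"
    by (meson INF_lower2 ennreal_leI)
qed

text \<open>A strict bound on the supremum bounds each infimum strictly, so a witness exists even
  where the infimum is not attained.\<close>

lemma set_dist_lessD:
  assumes "set_dist B A < ennreal r" "u \<in> B"
  shows "\<exists>v\<in>A. d_inf u v < r"
proof -
  have "(INF v\<in>A. ennreal (d_inf u v)) < ennreal r"
    using assms unfolding set_dist_def by (meson SUP_upper le_less_trans)
  then obtain v where "v \<in> A" "ennreal (d_inf u v) < ennreal r"
    by (auto simp: INF_less_iff)
  then show ?thesis by (meson ennreal_leI not_le)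
qed

section \<open>Descent directions\<close>

text \<open>\<open>arg_min\<close> is meaningful only once a minimiser exists; here the simplex is
  compact and the objective continuous.\<close>

lemma min_weights_properties:
  fixes g :: "'k::finite \<Rightarrow> 'v::real_normed_vector"
  shows "min_weights g $ i \<ge> 0" "(\<Sum>i\<in>UNIV. min_weights g $ i) = 1"
    and "(\<And>i. \<beta> $ i \<ge> 0) \<Longrightarrow> (\<Sum>i\<in>UNIV. \<beta> $ i) = 1 \<Longrightarrow>
           norm (qvec g) \<le> norm (\<Sum>i\<in>UNIV. \<beta> $ i *\<^sub>R g i)"
proof -
  define S :: "(real ^ 'k) set" where "S = {\<alpha>. (\<forall>i. \<alpha> $ i \<ge> 0) \<and> (\<Sum>i\<in>UNIV. \<alpha> $ i) = 1}"
  define f where "f = (\<lambda>\<alpha> :: real ^ 'k. (norm (\<Sum>i\<in>UNIV. \<alpha> $ i *\<^sub>R g i))\<^sup>2)"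
  have "closed S"
    unfolding S_def by (intro closed_Collect_conj closed_Collect_all closed_Collect_le
        closed_Collect_eq continuous_intros)
  moreover have "S \<subseteq> cbox 0 1"
  proof
    fix \<alpha> assume \<alpha>: "\<alpha> \<in> S"
    have "\<alpha> $ i \<le> 1" for i
      using \<alpha> member_le_sum[of i UNIV "\<lambda>i. \<alpha> $ i"] by (auto simp: S_def)
    with \<alpha> show "\<alpha> \<in> cbox 0 1" by (auto simp: S_def mem_box_cart)
  qed
  ultimately have "compact S"
    by (meson bounded_cbox bounded_subset compact_eq_bounded_closed)
  \<comment> \<open>A vertex of the simplex, at an arbitrary index, shows that it is
    nonempty.\<close>
  moreover have "axis undefined 1 \<in> S"
    by (auto simp: S_def axis_def if_distrib)
  moreover have "continuous_on S f"
    unfolding f_def by (intro continuous_intros)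
  ultimately obtain \<alpha> where \<alpha>: "\<alpha> \<in> S" "\<And>\<beta>. \<beta> \<in> S \<Longrightarrow> f \<alpha> \<le> f \<beta>"
    using continuous_attains_inf[of S f] by blast
  have "min_weights g \<in> S \<and> (\<forall>\<beta>\<in>S. f (min_weights g) \<le> f \<beta>)"
    unfolding min_weights_def f_def[symmetric]
  proof (rule arg_minI)
    show "(\<forall>i. \<alpha> $ i \<ge> 0) \<and> (\<Sum>i\<in>UNIV. \<alpha> $ i) = 1" using \<alpha> by (simp add: S_def)
  qed (use \<alpha> in \<open>auto simp: S_def not_less\<close>)
  then show "min_weights g $ i \<ge> 0" "(\<Sum>i\<in>UNIV. min_weights g $ i) = 1"
    and "(\<And>i. \<beta> $ i \<ge> 0) \<Longrightarrow> (\<Sum>i\<in>UNIV. \<beta> $ i) = 1 \<Longrightarrow>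
           norm (qvec g) \<le> norm (\<Sum>i\<in>UNIV. \<beta> $ i *\<^sub>R g i)"
    unfolding S_def f_def qvec_def by auto
qed

text \<open>The variational inequality for the projection of the origin onto the convex hull of the
  gradients, with \<open>qvec g\<close> as the projection. It is tested only on the segment from
  \<open>qvec g\<close> to \<open>g j\<close>.\<close>

lemma norm_qvec_le_inner:
  fixes g :: "'k::finite \<Rightarrow> 'v::euclidean_space"
  shows "(norm (qvec g))\<^sup>2 \<le> qvec g \<bullet> g j"
proof -
  have "(0 - qvec g) \<bullet> (g j - qvec g) \<le> 0"
  proof (rule any_closest_point_dot)
    show "\<forall>z\<in>closed_segment (qvec g) (g j). dist 0 (qvec g) \<le> dist 0 z"
    proof
      fix z assume "z \<in> closed_segment (qvec g) (g j)"
      then obtain t where t: "0 \<le> t" "t \<le> 1" and z: "z = (1 - t) *\<^sub>R qvec g + t *\<^sub>R g j"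
        by (auto simp: in_segment)
      \<comment> \<open>Interpolating the optimal weights with the vertex \<open>j\<close> gives
        admissible weights for \<open>z\<close>, so minimality applies.\<close>
      define \<beta> where "\<beta> = (1 - t) *\<^sub>R min_weights g + t *\<^sub>R axis j 1"
      have "\<beta> $ i \<ge> 0" for i
        using t min_weights_properties(1)[of g i] by (auto simp: \<beta>_def axis_def)
      moreover have "(\<Sum>i\<in>UNIV. \<beta> $ i) = 1"
        using min_weights_properties(2)[of g]
        by (simp add: \<beta>_def sum.distrib sum_distrib_left[symmetric] axis_def)
      moreover have "(\<Sum>i\<in>UNIV. axis j 1 $ i *\<^sub>R g i) = g j"
        by (simp add: axis_def if_distrib[of "\<lambda>c. c *\<^sub>R _"] cong: if_cong)
      then have "(\<Sum>i\<in>UNIV. \<beta> $ i *\<^sub>R g i) = z"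
        by (simp add: \<beta>_def z qvec_def scaleR_add_left sum.distrib
            flip: scaleR_scaleR scaleR_sum_right)
      ultimately show "dist 0 (qvec g) \<le> dist 0 z"
        using min_weights_properties(3)[of \<beta> g] by simp
    qed
  qed auto
  then show ?thesis
    by (simp add: inner_diff_right power2_norm_eq_inner)
qed

text \<open>Along \<open>- qvec g\<close> each component has derivative at most minus the squared
  norm of \<open>qvec g\<close>, which is negative. There are finitely many components, so one small
  step decreases all of them.\<close>

lemma exists_descent_point:
  fixes F :: "'v::euclidean_space \<Rightarrow> real ^ 'k"
  assumes grad: "\<And>i. GDERIV (\<lambda>y. F y $ i) x :> g i" and q: "qvec g \<noteq> 0" and "\<delta> > 0"
  shows "\<exists>z\<in>ball x \<delta>. F z <\<^sub>p F x"
proof -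
  define c where "c t = x - t *\<^sub>R qvec g" for t
  have c0: "c 0 = x" by (simp add: c_def)
  have "eventually (\<lambda>t. F (c t) $ i < F x $ i) (at_right 0)" for i
  proof -
    have "((\<lambda>y. F y $ i) has_derivative (\<lambda>h. h \<bullet> g i)) (at (c 0))"
      using grad[of i] unfolding gderiv_def c0 .
    moreover have "(c has_derivative (\<lambda>t. - (t *\<^sub>R qvec g))) (at 0)"
      unfolding c_def by (auto intro!: derivative_eq_intros)
    ultimately have "((\<lambda>t. F (c t) $ i) has_derivative (\<lambda>t. - (t *\<^sub>R qvec g) \<bullet> g i)) (at 0)"
      by (rule has_derivative_compose[rotated])
    then have "((\<lambda>t. F (c t) $ i) has_real_derivative - (qvec g \<bullet> g i)) (at 0)"
      unfolding has_field_derivative_def by (elim has_derivative_eq_rhs) (auto simp: fun_eq_iff)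
    moreover have "- (qvec g \<bullet> g i) < 0"
      using norm_qvec_le_inner[of g i] q by (smt (verit) zero_less_norm_iff zero_less_power)
    ultimately obtain d where "d > 0" "\<And>h. h > 0 \<Longrightarrow> h < d \<Longrightarrow> F (c (0 + h)) $ i < F (c 0) $ i"
      by (blast dest: has_real_derivative_neg_dec_right)
    then show ?thesis
      unfolding eventually_at_right_field c0 by auto
  qed
  then have "eventually (\<lambda>t. F (c t) <\<^sub>p F x) (at_right 0)"
    unfolding less_p_def by (rule eventually_all_finite)
  moreover have "(c \<longlongrightarrow> c 0) (at_right 0)"
    unfolding c_def by (intro tendsto_intros)
  then have "eventually (\<lambda>t. dist (c t) x < \<delta>) (at_right 0)"
    unfolding c0 using \<open>\<delta> > 0\<close> by (rule tendstoD)
  ultimately have "eventually (\<lambda>t. F (c t) <\<^sub>p F x \<and> dist (c t) x < \<delta>) (at_right 0)"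
    by (rule eventually_conj)
  then obtain t where "F (c t) <\<^sub>p F x" "dist (c t) x < \<delta>"
    using eventually_happens[of _ "at_right (0::real)"] trivial_limit_at_right_real by blast
  then show ?thesis by (auto simp: dist_commute)
qed

section \<open>Pareto points\<close>

text \<open>As \<epsilon> is positive, a point that reaches below \<open>F x\<close> after the shift
  by \<epsilon> already dominates \<open>x\<close>.\<close>

lemma pareto_subset_eps_pareto:
  assumes "\<And>i. \<epsilon> $ i > 0"
  shows "pareto_set F Q \<subseteq> eps_pareto_set F Q \<epsilon>"
proof
  fix x assume x: "x \<in> pareto_set F Q"
  have False if "y \<in> Q" "F y + \<epsilon> \<le> F x" for y
  proof -
    have lt: "F y $ i < F x $ i" for i
      using that(2) assms[of i] by (simp add: less_eq_vec_def) (smt (verit))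
    then have "F y \<le> F x" "F y \<noteq> F x" by (auto simp: less_eq_vec_def less_imp_le)
    with x that(1) show False by (auto simp: pareto_set_def dominates_def)
  qed
  with x show "x \<in> eps_pareto_set F Q \<epsilon>"
    by (auto simp: eps_pareto_set_def pareto_set_def eps_dominates_def)
qed

text \<open>Minimise the sum of the components over the points of \<open>Q\<close> whose image lies
  below \<open>F y\<close>. Any point dominating the minimiser would belong to the same compact set
  and have a smaller sum.\<close>

lemma exists_pareto_below:
  fixes F :: "'s::topological_space \<Rightarrow> real ^ 'k"
  assumes F: "continuous_on UNIV F" and "compact Q" "y \<in> Q"
  shows "\<exists>z\<in>pareto_set F Q. F z \<le> F y"
proof -
  define S where "S = Q \<inter> {z. F z \<le> F y}"
  define f where "f z = (\<Sum>i\<in>UNIV. F z $ i)" for z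
  have "closed {z. F z \<le> F y}"
    unfolding less_eq_vec_def
    by (intro closed_Collect_all closed_Collect_le continuous_intros F)
  then have "compact S"
    unfolding S_def using \<open>compact Q\<close> by (rule compact_Int_closed[rotated])
  moreover have "y \<in> S" using assms by (simp add: S_def)
  moreover have "continuous_on S f"
    unfolding f_def by (intro continuous_intros continuous_on_subset[OF F]) auto
  ultimately obtain z where z: "z \<in> S" "\<And>w. w \<in> S \<Longrightarrow> f z \<le> f w"
    using continuous_attains_inf[of S f] by blast
  have False if w: "w \<in> Q" "F w \<le> F z" "F w \<noteq> F z" for w
  proof -
    obtain i where "F w $ i \<noteq> F z $ i" using w(3) by (auto simp: vec_eq_iff)
    then have "f w < f z"
      unfolding f_def using w(2)
      by (intro sum_strict_mono_ex1) (auto simp: less_eq_vec_def less_le)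
    moreover have "w \<in> S" using w z by (auto simp: S_def)
    ultimately show False using z(2) by (auto simp: not_le[symmetric])
  qed
  then have "z \<in> pareto_set F Q"
    using z by (auto simp: S_def pareto_set_def dominates_def)
  then show ?thesis using z by (auto simp: S_def)
qed

text \<open>The points above the shifted image form the sum of a compact set and the closed
  nonnegative orthant. This sum is closed, so its complement has an open preimage under
  \<open>F\<close>.\<close>

lemma not_eps_dominated_nhd:
  fixes F :: "'s::metric_space \<Rightarrow> real ^ 'k"
  assumes F: "continuous_on UNIV F" and "compact Q"
    and "\<And>y. y \<in> Q \<Longrightarrow> \<not> F y + \<epsilon> \<le> F z"
  shows "\<exists>\<delta>>0. \<forall>p\<in>ball z \<delta>. \<forall>y\<in>Q. \<not> F y + \<epsilon> \<le> F p"
proof -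
  define C where "C = (\<Union>a\<in>(\<lambda>y. F y + \<epsilon>) ` Q. \<Union>b\<in>{b. 0 \<le> b}. {a + b})"
  have C: "v \<in> C \<longleftrightarrow> (\<exists>y\<in>Q. F y + \<epsilon> \<le> v)" for v
  proof
    assume "\<exists>y\<in>Q. F y + \<epsilon> \<le> v"
    then obtain y where "y \<in> Q" "F y + \<epsilon> \<le> v" by blast
    then have "v = (F y + \<epsilon>) + (v - (F y + \<epsilon>))" "0 \<le> v - (F y + \<epsilon>)" by simp_all
    with \<open>y \<in> Q\<close> show "v \<in> C" unfolding C_def by blast
  next
    assume "v \<in> C"
    then obtain y b where "y \<in> Q" "0 \<le> b" "v = F y + \<epsilon> + b" by (auto simp: C_def)
    then show "\<exists>y\<in>Q. F y + \<epsilon> \<le> v" by (intro bexI[of _ y]) auto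
  qed
  have "compact ((\<lambda>y. F y + \<epsilon>) ` Q)"
    by (intro compact_continuous_image continuous_intros continuous_on_subset[OF F] assms) auto
  moreover have "closed {b :: real ^ 'k. 0 \<le> b}"
    unfolding less_eq_vec_def by (intro closed_Collect_all closed_Collect_le continuous_intros)
  ultimately have "closed C"
    unfolding C_def by (rule compact_closed_sums)
  then have "open (F -` (- C))"
    using F by (intro open_vimage) auto
  moreover have "z \<in> F -` (- C)" using assms(3) by (auto simp: C)
  ultimately obtain \<delta> where "\<delta> > 0" "ball z \<delta> \<subseteq> F -` (- C)"
    by (meson open_contains_ball)
  then show ?thesis by (intro exI[of _ \<delta>]) (auto simp: C subset_iff)
qed

text \<open>
  If \<open>x\<close> itself touches the \<open>\<epsilon>\<close>-shifted image, then a small step along \<open>- qvec\<close> leaves it strictly.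
\<close>

lemma eps_pareto_undominated_ball:
  fixes F :: "'v::euclidean_space \<Rightarrow> real ^ 'k"
  assumes F: "continuous_on UNIV F" and "compact Q"
    and grad: "\<And>i x. GDERIV (\<lambda>y. F y $ i) x :> grad i x"
    and interior: "{x \<in> Q. \<exists>y \<in> pareto_set F Q. F y + \<epsilon> = F x} \<subseteq> interior Q"
    and q: "\<And>x y. x \<in> Q \<Longrightarrow> y \<in> pareto_set F Q \<Longrightarrow> F y + \<epsilon> = F x \<Longrightarrow> qvec (\<lambda>i. grad i x) \<noteq> 0"
    and x: "x \<in> eps_pareto_set F Q \<epsilon>" and "\<eta> > 0"
  shows "\<exists>z\<in>Q. \<exists>\<delta>>0. \<forall>p\<in>ball z \<delta>. d_inf (F x) (F p) \<le> \<eta> \<and> (\<forall>y\<in>Q. \<not> F y + \<epsilon> \<le> F p)"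
proof -
  have xQ: "x \<in> Q" and nd: "\<And>y. y \<in> Q \<Longrightarrow> F y + \<epsilon> \<le> F x \<Longrightarrow> F y + \<epsilon> = F x"
    using x by (auto simp: eps_pareto_set_def eps_dominates_def)
  have "isCont F x" using F by (simp add: continuous_on_eq_continuous_at)
  then obtain \<delta>\<^sub>0 where \<delta>\<^sub>0: "\<delta>\<^sub>0 > 0" "\<And>p. p \<in> ball x \<delta>\<^sub>0 \<Longrightarrow> dist (F x) (F p) < \<eta>"
    using \<open>\<eta> > 0\<close> unfolding continuous_at_eps_delta by (metis dist_commute mem_ball)
  obtain z where z: "z \<in> Q" "z \<in> ball x \<delta>\<^sub>0" "\<And>y. y \<in> Q \<Longrightarrow> \<not> F y + \<epsilon> \<le> F z"
  proof (cases "\<exists>y\<in>Q. F y + \<epsilon> = F x")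
    case True
    then obtain y where y: "y \<in> Q" "F y + \<epsilon> = F x" by blast
    \<comment> \<open>A point \<open>w\<close> dominating \<open>y\<close> would satisfy
      \<open>F w + \<epsilon> \<le> F x\<close>; by \<open>nd\<close> this is an equality, whence
      \<open>F w = F y\<close>.\<close>
    have "y \<in> pareto_set F Q"
    proof -
      have False if "w \<in> Q" "F w \<le> F y" "F w \<noteq> F y" for w
      proof -
        have "F w + \<epsilon> \<le> F x" using that(2) by (simp flip: y(2))
        from nd[OF that(1) this] that(3) show False by (simp flip: y(2))
      qed
      with y show ?thesis by (auto simp: pareto_set_def dominates_def)
    qed
    with xQ y interior q have "x \<in> interior Q" and q0: "qvec (\<lambda>i. grad i x) \<noteq> 0" by blast+
    then obtain \<delta>\<^sub>1 where \<delta>\<^sub>1: "\<delta>\<^sub>1 > 0" "ball x \<delta>\<^sub>1 \<subseteq> Q" by (auto simp: mem_interior)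
    obtain z where z: "z \<in> ball x (min \<delta>\<^sub>0 \<delta>\<^sub>1)" "F z <\<^sub>p F x"
      using exists_descent_point[of F x "\<lambda>i. grad i x" "min \<delta>\<^sub>0 \<delta>\<^sub>1"] grad q0 \<delta>\<^sub>0 \<delta>\<^sub>1 by auto
    \<comment> \<open>Anything below \<open>F z\<close> is strictly below \<open>F x\<close> in
      every coordinate, whereas \<open>nd\<close> permits only equality with
      \<open>F x\<close>.\<close>
    have "\<not> F w + \<epsilon> \<le> F z" if "w \<in> Q" for w
    proof
      assume le: "F w + \<epsilon> \<le> F z"
      have lt: "(F w + \<epsilon>) $ i < F x $ i" for i
        using le z(2) unfolding less_eq_vec_def less_p_def by (meson le_less_trans)
      then have "F w + \<epsilon> \<le> F x" by (simp add: less_eq_vec_def less_imp_le)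
      from nd[OF that this] lt show False by (metis less_irrefl)
    qed
    with z \<delta>\<^sub>1 show ?thesis by (intro that[of z]) auto
  next
    case False
    with xQ nd \<delta>\<^sub>0 show ?thesis by (intro that[of x]) auto
  qed
  obtain \<delta>\<^sub>2 where \<delta>\<^sub>2: "\<delta>\<^sub>2 > 0" "\<And>p y. p \<in> ball z \<delta>\<^sub>2 \<Longrightarrow> y \<in> Q \<Longrightarrow> \<not> F y + \<epsilon> \<le> F p"
    using not_eps_dominated_nhd[OF F \<open>compact Q\<close> z(3)] by blast
  obtain \<delta>\<^sub>3 where \<delta>\<^sub>3: "\<delta>\<^sub>3 > 0" "ball z \<delta>\<^sub>3 \<subseteq> ball x \<delta>\<^sub>0"
    using z(2) by (meson open_ball open_contains_ball)
  have "d_inf (F x) (F p) \<le> \<eta> \<and> (\<forall>y\<in>Q. \<not> F y + \<epsilon> \<le> F p)" if "p \<in> ball z (min \<delta>\<^sub>2 \<delta>\<^sub>3)" for p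
  proof -
    have "p \<in> ball z \<delta>\<^sub>2" "p \<in> ball x \<delta>\<^sub>0" using that \<delta>\<^sub>3 by auto
    then show ?thesis
      using \<delta>\<^sub>0(2) \<delta>\<^sub>2(2) d_inf_le_dist[of "F x" "F p"] by (meson less_imp_le order_trans)
  qed
  with z \<delta>\<^sub>2 \<delta>\<^sub>3 show ?thesis by (intro bexI[of _ z] exI[of _ "min \<delta>\<^sub>2 \<delta>\<^sub>3"]) auto
qed

section \<open>Invariants of the archive\<close>

text \<open>Separation is strict because a candidate at distance exactly \<open>\<Delta>s\<close> is
  rejected. Domination is excluded only for the shift \<open>\<epsilon> + vec \<Delta>\<close>: an
  accepted candidate may dominate older elements with shift \<epsilon>, and removal acts on the
  larger shift.\<close>

definition archive_inv ::
    "('s \<Rightarrow> real ^ 'k) \<Rightarrow> 's set \<Rightarrow> real ^ 'k \<Rightarrow> real \<Rightarrow> real \<Rightarrow> 's set \<Rightarrow> bool"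
  where "archive_inv F Q \<epsilon> \<Delta> \<Delta>s A \<longleftrightarrow> finite A \<and> A \<subseteq> Q \<and>
    (\<forall>a\<in>A. \<forall>b\<in>A. a \<noteq> b \<longrightarrow> d_inf (F a) (F b) > \<Delta>s) \<and>
    (\<forall>a\<in>A. \<forall>b\<in>A. \<not> eps_dominates F (\<epsilon> + vec \<Delta>) a b)"

lemma eps_dominates_add_vecD:
  assumes "eps_dominates F (\<epsilon> + vec \<Delta>) a b" "\<Delta> > 0"
  shows "eps_dominates F \<epsilon> a b"
proof -
  have "(F a + \<epsilon>) $ i < F b $ i" for i
  proof -
    have "(F a + (\<epsilon> + vec \<Delta>)) $ i \<le> F b $ i"
      using assms(1) by (simp only: eps_dominates_def less_eq_vec_def)
    with assms(2) show ?thesis by simp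
  qed
  then show ?thesis
    unfolding eps_dominates_def less_eq_vec_def by (metis less_imp_le less_irrefl)
qed

lemma not_eps_dominates_self:
  assumes "\<And>i. \<epsilon> $ i > 0"
  shows "\<not> eps_dominates F \<epsilon> a a"
  using assms by (auto simp: eps_dominates_def less_eq_vec_def not_le[symmetric])

context
  fixes F :: "'s \<Rightarrow> real ^ 'k" and Q :: "'s set" and \<epsilon> :: "real ^ 'k" and \<Delta> \<Delta>s :: real
  assumes \<epsilon>: "\<And>i. \<epsilon> $ i > 0" and \<Delta>s: "0 < \<Delta>s" "\<Delta>s < \<Delta>"
begin

text \<open>Between an accepted candidate and an older element, the acceptance test excludes
  domination in one direction and the removal excludes it in the other.\<close>

lemma archive_inv_step:
  assumes "archive_inv F Q \<epsilon> \<Delta> \<Delta>s A" "p \<in> Q"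
  shows "archive_inv F Q \<epsilon> \<Delta> \<Delta>s (archive_step F \<epsilon> \<Delta> \<Delta>s p A)"
proof (cases "(\<exists>a\<in>A. eps_dominates F \<epsilon> a p) \<or> (\<exists>a\<in>A. d_inf (F a) (F p) \<le> \<Delta>s)")
  case False
  then have step: "archive_step F \<epsilon> \<Delta> \<Delta>s p A = {a \<in> A \<union> {p}. \<not> eps_dominates F (\<epsilon> + vec \<Delta>) p a}"
    by (auto simp: archive_step_def)
  have far: "d_inf (F a) (F p) > \<Delta>s" "d_inf (F p) (F a) > \<Delta>s" if "a \<in> A" for a
    using that False by (auto simp: not_le d_inf_commute[of "F p"])
  have "\<not> eps_dominates F (\<epsilon> + vec \<Delta>) a p" if "a \<in> A" for a
    using that False eps_dominates_add_vecD \<Delta>s by (meson less_trans)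
  with far assms show ?thesis
    unfolding step archive_inv_def by auto
qed (use assms in \<open>auto simp: archive_step_def\<close>)

lemma archive_inv_fold:
  assumes "archive_inv F Q \<epsilon> \<Delta> \<Delta>s A" "set ps \<subseteq> Q"
  shows "archive_inv F Q \<epsilon> \<Delta> \<Delta>s (fold (archive_step F \<epsilon> \<Delta> \<Delta>s) ps A)"
  using assms by (induction ps arbitrary: A) (auto simp: archive_inv_step)

text \<open>If \<open>p\<close> removed an element \<open>a\<close> near \<open>F x\<close>, the
  margin \<Delta> in the removal test would exceed the distance \<open>r\<close>, and
  \<open>p\<close> would dominate \<open>x\<close> with shift \<epsilon>. This is impossible for
  \<open>x\<close> in the \<epsilon>-Pareto set.\<close>

lemma near_eps_pareto_step:
  assumes x: "x \<in> eps_pareto_set F Q \<epsilon>" and "r < \<Delta>" "p \<in> Q"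
    and near: "\<exists>a\<in>A. d_inf (F x) (F a) \<le> r"
  shows "\<exists>a\<in>archive_step F \<epsilon> \<Delta> \<Delta>s p A. d_inf (F x) (F a) \<le> r"
proof -
  obtain a where a: "a \<in> A" "d_inf (F x) (F a) \<le> r" using near by blast
  have "\<not> eps_dominates F (\<epsilon> + vec \<Delta>) p a"
  proof
    assume "eps_dominates F (\<epsilon> + vec \<Delta>) p a"
    then have le: "(F p + (\<epsilon> + vec \<Delta>)) $ i \<le> F a $ i" for i
      by (simp only: eps_dominates_def less_eq_vec_def)
    have lt: "(F p + \<epsilon>) $ i < F x $ i" for i
      using le[of i] abs_component_le_d_inf[of "F x" i "F a"] a(2) \<open>r < \<Delta>\<close> by simp
    then have "eps_dominates F \<epsilon> p x"
      unfolding eps_dominates_def less_eq_vec_def by (metis less_imp_le less_irrefl)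
    with x \<open>p \<in> Q\<close> show False by (auto simp: eps_pareto_set_def)
  qed
  with a show ?thesis by (auto simp: archive_step_def)
qed

lemma near_eps_pareto_fold:
  assumes "x \<in> eps_pareto_set F Q \<epsilon>" "r < \<Delta>" "set ps \<subseteq> Q"
    and "\<exists>a\<in>A. d_inf (F x) (F a) \<le> r"
  shows "\<exists>a\<in>fold (archive_step F \<epsilon> \<Delta> \<Delta>s) ps A. d_inf (F x) (F a) \<le> r"
  using assms(3,4) by (induction ps arbitrary: A) (auto simp: near_eps_pareto_step[OF assms(1,2)])

text \<open>No archive element can dominate such a \<open>p\<close>, so it is rejected only when an
  element within \<open>\<Delta>s\<close> is already present; otherwise \<open>p\<close> itself is
  kept.\<close>

lemma archive_step_near:
  assumes "A \<subseteq> Q" "\<And>y. y \<in> Q \<Longrightarrow> \<not> F y + \<epsilon> \<le> F p"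
  shows "\<exists>a\<in>archive_step F \<epsilon> \<Delta> \<Delta>s p A. d_inf (F p) (F a) \<le> \<Delta>s"
proof (cases "\<exists>a\<in>A. d_inf (F a) (F p) \<le> \<Delta>s")
  case True
  then show ?thesis by (auto simp: archive_step_def d_inf_commute)
next
  case False
  moreover have "\<not> eps_dominates F \<epsilon> a p" if "a \<in> A" for a
    using assms that by (auto simp: eps_dominates_def)
  \<comment> \<open>The removal filter also runs over the newly inserted \<open>p\<close>.\<close>
  moreover have "\<not> eps_dominates F (\<epsilon> + vec \<Delta>) p p"
    using \<epsilon> \<Delta>s by (intro not_eps_dominates_self) (simp add: add_pos_pos)
  ultimately have "p \<in> archive_step F \<epsilon> \<Delta> \<Delta>s p A"
    by (auto simp: archive_step_def)
  then show ?thesis using \<Delta>s by (auto intro!: bexI[of _ p])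
qed

context
  fixes Gen P A
  assumes run: "search_run Q (archive_updateP F \<epsilon> \<Delta> \<Delta>s) Gen P A"
begin

text \<open>Puts index 0 and successor indices into one form: \<open>B\<close> is the archive before
  \<open>P l\<close> is processed, which is empty at index 0.\<close>

lemma archive_fold:
  obtains ps B where "set ps = P l" "archive_inv F Q \<epsilon> \<Delta> \<Delta>s B"
    "A l = fold (archive_step F \<epsilon> \<Delta> \<Delta>s) ps B" "\<And>j. l = Suc j \<Longrightarrow> B = A j"
proof -
  have "\<exists>ps B. set ps = P l \<and> archive_inv F Q \<epsilon> \<Delta> \<Delta>s B \<and>
    A l = fold (archive_step F \<epsilon> \<Delta> \<Delta>s) ps B \<and> (\<forall>j. l = Suc j \<longrightarrow> B = A j)"
  proof (induction l)
    case 0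
    have "archive_inv F Q \<epsilon> \<Delta> \<Delta>s {}" by (simp add: archive_inv_def)
    with run show ?case by (auto simp: search_run_def archive_updateP_def)
  next
    case (Suc l)
    then have "archive_inv F Q \<epsilon> \<Delta> \<Delta>s (A l)"
      using run archive_inv_fold by (auto simp: search_run_def)
    with run show ?case by (force simp: search_run_def archive_updateP_def)
  qed
  then show ?thesis using that by blast
qed

lemma archive_inv: "archive_inv F Q \<epsilon> \<Delta> \<Delta>s (A l)"
proof -
  obtain ps B where "set ps = P l" "archive_inv F Q \<epsilon> \<Delta> \<Delta>s B"
    "A l = fold (archive_step F \<epsilon> \<Delta> \<Delta>s) ps B" by (rule archive_fold)
  with run show ?thesis by (auto simp: search_run_def intro!: archive_inv_fold)
qed

lemma archive_near_mono:
  assumes "x \<in> eps_pareto_set F Q \<epsilon>" "r < \<Delta>" "\<exists>a\<in>A l. d_inf (F x) (F a) \<le> r" "l \<le> l'"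
  shows "\<exists>a\<in>A l'. d_inf (F x) (F a) \<le> r"
  using assms(4)
proof (induction rule: dec_induct)
  case (step l')
  obtain ps B where "set ps = P (Suc l')" "B = A l'"
    "A (Suc l') = fold (archive_step F \<epsilon> \<Delta> \<Delta>s) ps B" by (rule archive_fold) blast
  moreover have "P (Suc l') \<subseteq> Q" using run unfolding search_run_def by blast
  ultimately show ?case
    using near_eps_pareto_fold[OF assms(1,2), of ps "A l'"] step.IH by simp
qed (use assms in simp)

text \<open>Right after \<open>p\<close> is processed, some element is within
  \<open>\<Delta>s\<close> of \<open>F p\<close>, hence within \<open>\<Delta>s + \<eta>\<close> of
  \<open>F x\<close>. Since \<open>r < \<Delta>\<close>, the remaining candidates of the same batch
  cannot destroy this nearness.\<close>

lemma archive_near_visited: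
  assumes x: "x \<in> eps_pareto_set F Q \<epsilon>" and r: "\<Delta>s + \<eta> \<le> r" "r < \<Delta>"
    and p: "p \<in> P l" "d_inf (F x) (F p) \<le> \<eta>" "\<And>y. y \<in> Q \<Longrightarrow> \<not> F y + \<epsilon> \<le> F p"
  shows "\<exists>a\<in>A l. d_inf (F x) (F a) \<le> r"
proof -
  obtain ps B where ps: "set ps = P l" and B: "archive_inv F Q \<epsilon> \<Delta> \<Delta>s B"
    and A: "A l = fold (archive_step F \<epsilon> \<Delta> \<Delta>s) ps B" by (rule archive_fold)
  have PQ: "P l \<subseteq> Q" using run by (simp add: search_run_def)
  obtain us vs where split: "ps = us @ p # vs" using p(1) ps by (metis split_list)
  define C where "C = fold (archive_step F \<epsilon> \<Delta> \<Delta>s) us B"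
  have sub: "set us \<subseteq> Q" "set vs \<subseteq> Q" using ps PQ split by auto
  then have "C \<subseteq> Q" using archive_inv_fold[OF B] by (auto simp: C_def archive_inv_def)
  then obtain a where "a \<in> archive_step F \<epsilon> \<Delta> \<Delta>s p C" "d_inf (F p) (F a) \<le> \<Delta>s"
    using archive_step_near p(3) by blast
  moreover from this have "d_inf (F x) (F a) \<le> r"
    using d_inf_triangle[of "F x" "F a" "F p"] p(2) r by linarith
  ultimately show ?thesis
    using near_eps_pareto_fold[OF x r(2) sub(2)] by (auto simp: A split C_def)
qed

end

end

section \<open>Convergence\<close>

text \<open>One \<Delta> of the shift \<open>\<epsilon> + 2 *\<^sub>R vec \<Delta>\<close> pays for
  replacing a dominating point of \<open>Q\<close> by a nearby archive element; the other \<Delta>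
  remains and contradicts the invariant.\<close>

lemma archive_close_of_set_dist_less:
  fixes F :: "'s::topological_space \<Rightarrow> real ^ 'k"
  assumes F: "continuous_on UNIV F" and Q: "compact Q" and \<epsilon>: "\<And>i. \<epsilon> $ i > 0"
    and inv: "archive_inv F Q \<epsilon> \<Delta> \<Delta>s A"
    and b1: "set_dist (F ` eps_pareto_set F Q \<epsilon>) (F ` A) < ennreal \<Delta>"
  shows "archive_close F Q \<epsilon> \<Delta> A"
proof -
  have "A \<subseteq> eps_pareto_set F Q (\<epsilon> + 2 *\<^sub>R vec \<Delta>)"
  proof
    fix a assume a: "a \<in> A"
    have False if y: "y \<in> Q" "F y + (\<epsilon> + 2 *\<^sub>R vec \<Delta>) \<le> F a" for y
    proof -
      \<comment> \<open>The bound \<open>b1\<close> concerns the \<epsilon>-Pareto set, to which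
        \<open>y\<close> need not belong; a Pareto point below \<open>y\<close> does.\<close>
      obtain z where z: "z \<in> pareto_set F Q" "F z \<le> F y"
        using exists_pareto_below[OF F Q y(1)] by blast
      then have "z \<in> eps_pareto_set F Q \<epsilon>"
        by (intro subsetD[OF pareto_subset_eps_pareto[OF \<epsilon>]])
      then obtain b where b: "b \<in> A" "d_inf (F z) (F b) < \<Delta>"
        using set_dist_lessD[OF b1] by blast
      have lt: "(F b + (\<epsilon> + vec \<Delta>)) $ i < F a $ i" for i
      proof -
        have "(F y + (\<epsilon> + 2 *\<^sub>R vec \<Delta>)) $ i \<le> F a $ i" "F z $ i \<le> F y $ i"
          using y(2) z(2) unfolding less_eq_vec_def by blast+
        then show ?thesis
          using abs_component_le_d_inf[of "F z" i "F b"] b(2) by simp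
      qed
      then have "eps_dominates F (\<epsilon> + vec \<Delta>) b a"
        unfolding eps_dominates_def less_eq_vec_def by (metis less_imp_le less_irrefl)
      with a b(1) inv show False by (auto simp: archive_inv_def)
    qed
    with a inv show "a \<in> eps_pareto_set F Q (\<epsilon> + 2 *\<^sub>R vec \<Delta>)"
      by (auto simp: archive_inv_def eps_pareto_set_def eps_dominates_def)
  qed
  then have "set_dist (F ` A) (F ` eps_pareto_set F Q \<epsilon>) \<le>
      set_dist (F ` eps_pareto_set F Q (\<epsilon> + 2 *\<^sub>R vec \<Delta>)) (F ` eps_pareto_set F Q \<epsilon>)"
    by (intro set_dist_mono image_mono)
  with b1 show ?thesis
    by (auto simp: archive_close_def Let_def hausdorff_dist_def le_max_iff_disj less_imp_le)
qed

text \<open>The deterministic core, for a single run with dense candidates. Each point of the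
  \<epsilon>-Pareto set has its own index of approximation, and a finite net in the image makes the
  index uniform.\<close>

lemma eventually_archive_close:
  fixes F :: "'v::euclidean_space \<Rightarrow> real ^ 'k"
  assumes F: "continuous_on UNIV F" and Q: "compact Q"
    and \<epsilon>: "\<And>i. \<epsilon> $ i > 0" and \<Delta>: "0 < \<Delta>s" "\<Delta>s < \<Delta>"
    and run: "search_run Q (archive_updateP F \<epsilon> \<Delta> \<Delta>s) Gen P A"
    and dense: "\<And>x \<delta>. x \<in> Q \<Longrightarrow> \<delta> > 0 \<Longrightarrow> \<exists>l. P l \<inter> ball x \<delta> \<noteq> {}"
    and undominated: "\<And>x \<eta>. x \<in> eps_pareto_set F Q \<epsilon> \<Longrightarrow> \<eta> > 0 \<Longrightarrow> \<exists>z\<in>Q. \<exists>\<delta>>0. \<forall>p\<in>ball z \<delta>.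
      d_inf (F x) (F p) \<le> \<eta> \<and> (\<forall>y\<in>Q. \<not> F y + \<epsilon> \<le> F p)"
  shows "\<exists>l\<^sub>0. \<forall>l\<ge>l\<^sub>0. archive_close F Q \<epsilon> \<Delta> (A l)"
proof -
  \<comment> \<open>One third of the gap is spent on the visited point, one on the net, and the last
    keeps the final inequality strict.\<close>
  define \<eta> where "\<eta> = (\<Delta> - \<Delta>s) / 3"
  have \<eta>: "\<eta> > 0" "\<Delta>s + \<eta> < \<Delta>" "\<Delta>s + 2 * \<eta> < \<Delta>" using \<Delta> by (auto simp: \<eta>_def field_simps)
  define E where "E = eps_pareto_set F Q \<epsilon>"
  have ev: "\<exists>l\<^sub>0. \<forall>l\<ge>l\<^sub>0. \<exists>a\<in>A l. d_inf (F x) (F a) \<le> \<Delta>s + \<eta>" if x: "x \<in> E" for x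
  proof -
    obtain z \<delta> where z: "z \<in> Q" "\<delta> > 0"
      "\<And>p. p \<in> ball z \<delta> \<Longrightarrow> d_inf (F x) (F p) \<le> \<eta> \<and> (\<forall>y\<in>Q. \<not> F y + \<epsilon> \<le> F p)"
      using undominated[of x \<eta>] x \<eta> unfolding E_def by blast
    obtain l p where "p \<in> P l" "p \<in> ball z \<delta>" using dense[OF z(1,2)] by blast
    then have "\<exists>a\<in>A l. d_inf (F x) (F a) \<le> \<Delta>s + \<eta>"
      using archive_near_visited[OF \<epsilon> \<Delta> run, of x \<eta> "\<Delta>s + \<eta>" p l] x z(3) \<eta> by (simp add: E_def)
    then show ?thesis
      using archive_near_mono[OF \<epsilon> \<Delta> run] x \<eta>(2) unfolding E_def by blast
  qed
  then obtain L where L: "\<And>x l. x \<in> E \<Longrightarrow> l \<ge> L x \<Longrightarrow> \<exists>a\<in>A l. d_inf (F x) (F a) \<le> \<Delta>s + \<eta>"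
    by metis
  have "E \<subseteq> Q" by (auto simp: E_def eps_pareto_set_def)
  have "compact (F ` Q)" by (intro compact_continuous_image continuous_on_subset[OF F] Q) auto
  \<comment> \<open>\<open>E\<close> need not be closed, so the closure of its image is covered, by
    balls whose centres still come from \<open>E\<close>.\<close>
  then have "compact (closure (F ` E))"
    using \<open>E \<subseteq> Q\<close> by (meson bounded_subset compact_closure compact_imp_bounded image_mono)
  moreover have "closure (F ` E) \<subseteq> (\<Union>x\<in>E. ball (F x) \<eta>)"
  proof
    fix u assume "u \<in> closure (F ` E)"
    then obtain x where "x \<in> E" "dist (F x) u < \<eta>"
      using \<eta>(1) by (auto simp: closure_approachable)
    then show "u \<in> (\<Union>x\<in>E. ball (F x) \<eta>)" by auto
  qed
  ultimately obtain D where D: "D \<subseteq> E" "finite D" "closure (F ` E) \<subseteq> (\<Union>x\<in>D. ball (F x) \<eta>)"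
    by (elim compactE_image[of _ E "\<lambda>x. ball (F x) \<eta>"]) auto
  show ?thesis
  proof (intro exI allI impI)
    \<comment> \<open>Inserting 0 keeps the maximum meaningful when \<open>D\<close> is
      empty.\<close>
    fix l assume l: "l \<ge> Max (insert 0 (L ` D))"
    have "set_dist (F ` E) (F ` A l) \<le> ennreal (\<Delta>s + 2 * \<eta>)"
    proof (rule set_dist_le)
      fix u assume "u \<in> F ` E"
      then have "u \<in> closure (F ` E)" by (rule subsetD[OF closure_subset])
      then obtain x where x: "x \<in> D" "dist (F x) u < \<eta>" using D(3) by auto
      have "L x \<le> l" using l x(1) D(2) by simp
      then obtain a where a: "a \<in> A l" "d_inf (F x) (F a) \<le> \<Delta>s + \<eta>" using L x(1) D(1) by blast
      have "d_inf u (F a) \<le> \<Delta>s + 2 * \<eta>"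
        using d_inf_triangle[of u "F a" "F x"] d_inf_le_dist[of u "F x"] a(2) x(2)
        by (simp add: dist_commute)
      with a(1) show "\<exists>v\<in>F ` A l. d_inf u v \<le> \<Delta>s + 2 * \<eta>" by blast
    qed
    also have "\<dots> < ennreal \<Delta>" using \<eta> \<Delta> by (intro ennreal_lessI) auto
    finally have "set_dist (F ` E) (F ` A l) < ennreal \<Delta>" .
    then show "archive_close F Q \<epsilon> \<Delta> (A l)"
      unfolding E_def using archive_inv[OF \<epsilon> \<Delta> run, of l]
      by (intro archive_close_of_set_dist_less[OF F Q \<epsilon>])
  qed
qed

text \<open>The exceptional null set depends on centre and radius, of which there are uncountably
  many. A countable dense subset of \<open>Q\<close> and the radii
  \<open>inverse (real (Suc n))\<close> suffice, and countably many null sets have a null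
  union.\<close>

lemma (in prob_space) AE_hits_all_balls:
  fixes P :: "nat \<Rightarrow> 'a \<Rightarrow> ('v::{metric_space, second_countable_topology}) set"
  assumes "\<And>x \<delta>. x \<in> Q \<Longrightarrow> \<delta> > 0 \<Longrightarrow> prob {\<omega> \<in> space M. \<exists>l. P l \<omega> \<inter> ball x \<delta> \<inter> Q \<noteq> {}} = 1"
  shows "AE \<omega> in M. \<forall>x\<in>Q. \<forall>\<delta>>0. \<exists>l. P l \<omega> \<inter> ball x \<delta> \<noteq> {}"
proof -
  obtain T where T: "countable T" "T \<subseteq> Q" "Q \<subseteq> closure T" by (rule separable)
  have "AE \<omega> in M. \<exists>l. P l \<omega> \<inter> ball x (inverse (real (Suc n))) \<inter> Q \<noteq> {}" if "x \<in> T" for x n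
    using AE_prob_1[OF assms[of x "inverse (real (Suc n))"]] that T(2) by (auto elim!: AE_mp)
  then have "AE \<omega> in M. \<forall>x\<in>T. \<forall>n. \<exists>l. P l \<omega> \<inter> ball x (inverse (real (Suc n))) \<inter> Q \<noteq> {}"
    by (simp add: AE_ball_countable[OF T(1)] AE_all_countable)
  then show ?thesis
  proof (rule AE_mp, intro AE_I2 impI ballI allI)
    fix \<omega> x and \<delta> :: real
    assume hits: "\<forall>x\<in>T. \<forall>n. \<exists>l. P l \<omega> \<inter> ball x (inverse (real (Suc n))) \<inter> Q \<noteq> {}"
      and "x \<in> Q" "\<delta> > 0"
    obtain n where n: "inverse (real (Suc n)) < \<delta> / 2"
      using reals_Archimedean[of "\<delta> / 2"] \<open>\<delta> > 0\<close> by auto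
    obtain t where t: "t \<in> T" "dist t x < \<delta> / 2"
      using T(3) \<open>x \<in> Q\<close> \<open>\<delta> > 0\<close> by (meson closure_approachable half_gt_zero subsetD)
    obtain l p where p: "p \<in> P l \<omega>" "dist t p < inverse (real (Suc n))"
      using hits t(1) by (fastforce simp del: of_nat_Suc)
    have "dist x p < \<delta>" using dist_triangle[of x p t] p(2) t(2) n by (simp add: dist_commute)
    with p(1) show "\<exists>l. P l \<omega> \<inter> ball x \<delta> \<noteq> {}" by (metis disjoint_iff mem_ball)
  qed
qed

section \<open>Packing cubes into slabs\<close>

text \<open>Cubes of side \<open>s\<close> centred at the points \<open>G a\<close> are disjoint and
  fit into the box enlarged by \<open>s / 2\<close> on every side; compare volumes.\<close>

lemma card_separated_le_volume:
  fixes G :: "'s \<Rightarrow> real ^ 'k"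
  assumes "finite S" "s > 0" and le: "\<And>i. lo $ i \<le> hi $ i"
    and sep: "\<And>a b. a \<in> S \<Longrightarrow> b \<in> S \<Longrightarrow> a \<noteq> b \<Longrightarrow> d_inf (G a) (G b) \<ge> s"
    and in_box: "\<And>a i. a \<in> S \<Longrightarrow> lo $ i \<le> G a $ i \<and> G a $ i \<le> hi $ i"
  shows "real (card S) * s ^ CARD('k) \<le> (\<Prod>i\<in>UNIV. hi $ i - lo $ i + s)"
proof -
  \<comment> \<open>The cubes are open because two centres may be at distance exactly
    \<open>s\<close>.\<close>
  define K where "K a = box (G a - vec (s / 2)) (G a + vec (s / 2))" for a
  define T where "T = cbox (lo - vec (s / 2)) (hi + vec (s / 2))"
  have fm: "K a \<in> fmeasurable lborel" for a
    unfolding K_def by (rule fmeasurable_box)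
  have measK: "measure lborel (K a) = s ^ CARD('k)" for a
  proof -
    have "measure lborel (K a) = measure lborel (cbox (G a - vec (s / 2)) (G a + vec (s / 2)))"
      unfolding K_def by (simp add: measure_lborel_box_eq measure_lborel_cbox_eq)
    also have "\<dots> = s ^ CARD('k)"
      using \<open>s > 0\<close> by (subst content_cbox_cart) (auto simp: interval_ne_empty_cart)
    finally show ?thesis .
  qed
  have "disjoint_family_on K S"
    unfolding disjoint_family_on_def
  proof (intro ballI impI equals0I)
    fix a b z assume ab: "a \<in> S" "b \<in> S" "a \<noteq> b" and "z \<in> K a \<inter> K b"
    then have "\<bar>G a $ i - G b $ i\<bar> < s" for i
      by (simp add: K_def mem_box_cart abs_less_iff) (smt (verit) field_sum_of_halves)
    moreover obtain i where "d_inf (G a) (G b) = \<bar>G a $ i - G b $ i\<bar>"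
      using d_inf_attained by blast
    ultimately show False using sep[OF ab] by (metis not_le)
  qed
  moreover have "K ` S \<subseteq> sets lborel" by (auto simp: K_def)
  ultimately have "measure lborel (\<Union>a\<in>S. K a) = (\<Sum>a\<in>S. measure lborel (K a))"
    using fmeasurableD2[OF fm] by (intro measure_finite_Union \<open>finite S\<close>) simp_all
  also have "\<dots> = real (card S) * s ^ CARD('k)" by (simp add: measK)
  finally have "real (card S) * s ^ CARD('k) = measure lborel (\<Union>a\<in>S. K a)" by simp
  also have "\<dots> \<le> measure lborel T"
  proof (rule measure_mono_fmeasurable)
    have "z \<in> T" if "a \<in> S" "z \<in> K a" for a z
      unfolding T_def mem_box_cart
    proof
      fix i
      have "G a $ i - s / 2 < z $ i" "z $ i < G a $ i + s / 2"
        using that(2) by (auto simp: K_def mem_box_cart)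
      with in_box[OF that(1), of i]
      show "(lo - vec (s / 2)) $ i \<le> z $ i \<and> z $ i \<le> (hi + vec (s / 2)) $ i"
        by simp
    qed
    then show "(\<Union>a\<in>S. K a) \<subseteq> T" by blast
    show "(\<Union>a\<in>S. K a) \<in> sets lborel"
      using fm by (intro fmeasurableD fmeasurable.finite_UN \<open>finite S\<close>)
    show "T \<in> fmeasurable lborel" by (auto simp: T_def)
  qed
  also have "\<dots> = (\<Prod>i\<in>UNIV. hi $ i - lo $ i + s)"
  proof -
    have "cbox (lo - vec (s / 2)) (hi + vec (s / 2)) \<noteq> {}"
      using le \<open>s > 0\<close> by (simp add: interval_ne_empty_cart) (smt (verit) half_gt_zero)
    then show ?thesis unfolding T_def by (subst content_cbox_cart) (auto intro!: prod.cong)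
  qed
  finally show ?thesis .
qed

text \<open>
  Translating each image point backwards by a multiple of \<open>c = \<epsilon> + vec (\<Delta> + \<Delta>s)\<close>, as far as the
  box \<open>[m, M]\<close> allows, moves it to within \<open>c $ i\<close> of some face \<open>z $ i = m $ i\<close>. Points translated by
  different multiples stay \<open>\<Delta>s\<close>-separated, since otherwise one of the original points would
  \<open>-(\<epsilon> + vec \<Delta>)\<close>-dominate the other.
\<close>

lemma card_archive_le:
  fixes F :: "'s \<Rightarrow> real ^ 'k"
  assumes inv: "archive_inv F Q \<epsilon> \<Delta> \<Delta>s A"
    and \<epsilon>: "\<And>i. \<epsilon> $ i > 0" and \<Delta>: "0 < \<Delta>s" "\<Delta>s < \<Delta>"
    and mM: "\<And>i. m $ i \<le> M $ i" "\<And>i x. x \<in> Q \<Longrightarrow> m $ i \<le> F x $ i \<and> F x $ i \<le> M $ i"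
  shows "real (card A) \<le> (1 / \<Delta>s) ^ CARD('k) *
    (\<Sum>i\<in>UNIV. (\<epsilon> $ i + 2 * \<Delta> + \<Delta>s) * (\<Prod>j\<in>UNIV - {i}. M $ j - m $ j + \<Delta>s))"
proof -
  \<comment> \<open>The extra \<open>\<Delta>s\<close> absorbs the distance between two translated
    points that are closer than \<open>\<Delta>s\<close>.\<close>
  define c where "c = \<epsilon> + vec (\<Delta> + \<Delta>s)"
  have c: "c $ i > 0" "c $ i = \<epsilon> $ i + \<Delta> + \<Delta>s" for i
    using \<epsilon>[of i] \<Delta> by (auto simp: c_def)
  have A: "finite A" "A \<subseteq> Q" using inv by (auto simp: archive_inv_def)
  have "\<exists>n. (\<forall>i. m $ i \<le> (F a - real n *\<^sub>R c) $ i) \<and> (\<exists>i. (F a - real n *\<^sub>R c) $ i < m $ i + c $ i)"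
    if a: "a \<in> A" for a
  proof -
    obtain n where n: "F a $ i - m $ i < real n * c $ i" for i :: 'k
    proof -
      have "\<forall>i. \<exists>n. F a $ i - m $ i < real n * c $ i"
        using c(1) by (blast intro: reals_Archimedean3[rule_format])
      then obtain n where n: "\<And>i. F a $ i - m $ i < real (n i) * c $ i" by metis
      have "real (n i) * c $ i \<le> real (Max (range n)) * c $ i" for i
        using c(1)[of i] by (intro mult_right_mono) auto
      with n show ?thesis by (intro that[of "Max (range n)"]) (meson less_le_trans)
    qed
    define bad where "bad n \<longleftrightarrow> (\<exists>i. (F a - real n *\<^sub>R c) $ i < m $ i)" for n
    have "bad n" using n[of undefined] unfolding bad_def by (auto intro!: exI[of _ undefined])
    moreover have "\<not> bad 0" using mM(2) a A by (auto simp: bad_def not_less)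
    \<comment> \<open>\<open>k\<close> counts the translations made before some coordinate first
      drops below \<open>m\<close>; in that coordinate less than \<open>c\<close> is left above
      \<open>m\<close>.\<close>
    ultimately obtain k where k: "\<not> bad k" "bad (Suc k)"
      using ex_least_nat_less[of bad n] by (metis le_refl lessI)
    then show ?thesis
      by (intro exI[of _ k]) (auto simp: bad_def not_less algebra_simps)
  qed
  then obtain n where n: "\<And>a i. a \<in> A \<Longrightarrow> m $ i \<le> (F a - real (n a) *\<^sub>R c) $ i"
    "\<And>a. a \<in> A \<Longrightarrow> \<exists>i. (F a - real (n a) *\<^sub>R c) $ i < m $ i + c $ i" by metis
  define G where "G a = F a - real (n a) *\<^sub>R c" for a
  have sep_less: "d_inf (G a) (G b) \<ge> \<Delta>s" if ab: "a \<in> A" "b \<in> A" "n a < n b" for a b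
  proof (rule ccontr)
    assume "\<not> ?thesis"
    then have close: "\<bar>G a $ i - G b $ i\<bar> < \<Delta>s" for i
      using abs_component_le_d_inf[of "G a" i "G b"] by linarith
    \<comment> \<open>Undoing the translations adds at least one more \<open>c\<close> to
      \<open>b\<close> than to \<open>a\<close>; after losing less than \<open>\<Delta>s\<close>,
      more than \<open>\<epsilon> + vec \<Delta>\<close> remains in every coordinate.\<close>
    have lt: "(F a + (\<epsilon> + vec \<Delta>)) $ i < F b $ i" for i
    proof -
      have "1 * c $ i \<le> (real (n b) - real (n a)) * c $ i"
        using ab(3) c(1)[of i] by (intro mult_right_mono) auto
      then have "c $ i \<le> real (n b) * c $ i - real (n a) * c $ i" by (simp add: left_diff_distrib)
      with close[of i] c(2)[of i] show ?thesis by (simp add: G_def)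
    qed
    then have "eps_dominates F (\<epsilon> + vec \<Delta>) a b"
      unfolding eps_dominates_def less_eq_vec_def by (metis less_imp_le less_irrefl)
    with ab inv show False by (auto simp: archive_inv_def)
  qed
  have sep: "d_inf (G a) (G b) \<ge> \<Delta>s" if ab: "a \<in> A" "b \<in> A" "a \<noteq> b" for a b
  proof (cases "n a = n b")
    case True
    then have "d_inf (G a) (G b) = d_inf (F a) (F b)" by (simp add: G_def d_inf_def)
    with ab inv show ?thesis by (auto simp: archive_inv_def less_imp_le)
  next
    case False
    then show ?thesis
      using sep_less[of a b] sep_less[of b a] ab by (metis d_inf_commute linorder_neqE_nat)
  qed
  define S where "S i = {a \<in> A. G a $ i < m $ i + c $ i}" for i
  \<comment> \<open>Upper corner of the slab of thickness \<open>c $ i\<close> at the lower face in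
    direction \<open>i\<close>. The slab may stick out of the box there, which does not affect the
    volume estimate.\<close>
  define hi where "hi i = (\<chi> j. if j = i then m $ i + c $ i else M $ j)" for i
  have GM: "G a $ i \<le> M $ i" if "a \<in> A" for a i
    using mM(2)[of a i] that A c(1)[of i] by (simp add: G_def add_increasing2 subset_iff)
      (smt (verit) mult_nonneg_nonneg of_nat_0_le_iff)
  have card_S: "real (card (S i)) * \<Delta>s ^ CARD('k) \<le>
      (\<epsilon> $ i + 2 * \<Delta> + \<Delta>s) * (\<Prod>j\<in>UNIV - {i}. M $ j - m $ j + \<Delta>s)" for i
  proof -
    have "real (card (S i)) * \<Delta>s ^ CARD('k) \<le> (\<Prod>j\<in>UNIV. hi i $ j - m $ j + \<Delta>s)"
    proof (rule card_separated_le_volume[where G = G])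
      show "m $ j \<le> hi i $ j" for j using mM(1) c(1)[of i] by (simp add: hi_def)
      show "m $ j \<le> G a $ j \<and> G a $ j \<le> hi i $ j" if "a \<in> S i" for a j
        using that n(1)[of a j] GM[of a j] by (simp add: S_def G_def hi_def)
    qed (use A \<Delta> sep in \<open>auto simp: S_def\<close>)
    also have "\<dots> = (c $ i + \<Delta>s) * (\<Prod>j\<in>UNIV - {i}. M $ j - m $ j + \<Delta>s)"
      by (subst prod.remove[of UNIV i]) (auto simp: hi_def intro!: prod.cong)
    \<comment> \<open>The enlarged thickness is
      \<open>\<epsilon> $ i + \<Delta> + 2 * \<Delta>s\<close>; replacing one
      \<open>\<Delta>s\<close> by the larger \<Delta> gives the stated factor.\<close>
    also have "\<dots> \<le> (\<epsilon> $ i + 2 * \<Delta> + \<Delta>s) * (\<Prod>j\<in>UNIV - {i}. M $ j - m $ j + \<Delta>s)"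
      using c(2)[of i] \<Delta> mM(1) by (intro mult_right_mono prod_nonneg) (auto simp: add_increasing2)
    finally show ?thesis .
  qed
  \<comment> \<open>By the choice of \<open>n\<close>, every translated point lies in some slab, so
    the slab bounds add up.\<close>
  have "A \<subseteq> (\<Union>i. S i)" using n(2) by (auto simp: S_def G_def)
  then have "card A \<le> card (\<Union>i. S i)" using A by (intro card_mono) (auto simp: S_def)
  also have "\<dots> \<le> (\<Sum>i\<in>UNIV. card (S i))" by (rule card_UN_le) simp
  finally have "real (card A) \<le> (\<Sum>i\<in>UNIV. real (card (S i)))"
    by (simp flip: of_nat_sum)
  then have "real (card A) * \<Delta>s ^ CARD('k) \<le> (\<Sum>i\<in>UNIV. real (card (S i))) * \<Delta>s ^ CARD('k)"
    using \<Delta> by (intro mult_right_mono) auto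
  also have "\<dots> = (\<Sum>i\<in>UNIV. real (card (S i)) * \<Delta>s ^ CARD('k))"
    by (rule sum_distrib_right)
  also have "\<dots> \<le> (\<Sum>i\<in>UNIV. (\<epsilon> $ i + 2 * \<Delta> + \<Delta>s) * (\<Prod>j\<in>UNIV - {i}. M $ j - m $ j + \<Delta>s))"
    by (intro sum_mono card_S)
  finally show ?thesis
    using \<Delta> by (simp add: power_one_over field_simps)
qed

section \<open>Almost sure convergence and the bound on the archive size\<close>

theorem theorem4p1:
  fixes F :: "real ^ 'n \<Rightarrow> real ^ 'k"
    and grad :: "'k \<Rightarrow> real ^ 'n \<Rightarrow> real ^ 'n"
    and Q :: "(real ^ 'n) set"
    and \<epsilon> m M :: "real ^ 'k"
    and \<Delta> \<Delta>s :: real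
    and \<Omega> :: "'w measure"
    and Gen :: "nat \<Rightarrow> 'w \<Rightarrow> (real ^ 'n) set \<Rightarrow> (real ^ 'n) set"
    and P A :: "nat \<Rightarrow> 'w \<Rightarrow> (real ^ 'n) set"
  assumes "continuous_on UNIV F"
    and "\<And>i x. GDERIV (\<lambda>y. F y $ i) x :> grad i x"
    and "\<And>i. continuous_on UNIV (grad i)"
    and "compact Q"
    and "\<And>i. \<epsilon> $ i > 0"
    and "0 < \<Delta>s" and "\<Delta>s < \<Delta>"
    and "prob_space \<Omega>"
    and search: "\<And>\<omega>. \<omega> \<in> space \<Omega> \<Longrightarrow>
      search_run Q (archive_updateP F \<epsilon> \<Delta> \<Delta>s) (\<lambda>j. Gen j \<omega>) (\<lambda>j. P j \<omega>) (\<lambda>j. A j \<omega>)"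
    and generation: "\<And>x \<delta>. x \<in> Q \<Longrightarrow> \<delta> > 0 \<Longrightarrow>
      measure \<Omega> {\<omega> \<in> space \<Omega>. \<exists>l. P l \<omega> \<inter> ball x \<delta> \<inter> Q \<noteq> {}} = 1"
    and A1: "\<not> (\<exists>x \<in> Q - pareto_set F Q. weak_pareto F Q x)"
    and A2: "\<not> (\<exists>x \<in> Q - closure (eps_pareto_set F Q \<epsilon>). eps_weak_pareto F Q \<epsilon> x)"
    and A3: "{x \<in> Q. \<exists>y \<in> pareto_set F Q. F y + \<epsilon> = F x} \<subseteq> interior Q"
      "\<And>x y. x \<in> Q \<Longrightarrow> y \<in> pareto_set F Q \<Longrightarrow> F y + \<epsilon> = F x \<Longrightarrow> qvec (\<lambda>i. grad i x) \<noteq> 0"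
    and m: "\<And>i. m $ i \<in> (\<lambda>x. F x $ i) ` Q" "\<And>i x. x \<in> Q \<Longrightarrow> m $ i \<le> F x $ i"
    and M: "\<And>i. M $ i \<in> (\<lambda>x. F x $ i) ` Q" "\<And>i x. x \<in> Q \<Longrightarrow> F x $ i \<le> M $ i"
  shows "(AE \<omega> in \<Omega>. \<exists>l\<^sub>0. \<forall>l\<ge>l\<^sub>0. archive_close F Q \<epsilon> \<Delta> (A l \<omega>)) \<and>
    (\<forall>\<omega> \<in> space \<Omega>. \<forall>l\<^sub>0. (\<forall>l\<ge>l\<^sub>0. archive_close F Q \<epsilon> \<Delta> (A l \<omega>)) \<longrightarrow>
      (\<forall>l\<ge>l\<^sub>0. finite (A l \<omega>) \<and>
        real (card (A l \<omega>)) \<le> (1 / \<Delta>s) ^ CARD('k) *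
          (\<Sum>i\<in>UNIV. (\<epsilon> $ i + 2 * \<Delta> + \<Delta>s) * (\<Prod>j\<in>UNIV - {i}. M $ j - m $ j + \<Delta>s))))"
proof (intro conjI ballI allI impI)
  interpret prob_space \<Omega> by fact
  \<comment> \<open>Probability enters only through this event; on it the argument is deterministic
    for each outcome.\<close>
  have "AE \<omega> in \<Omega>. \<forall>x\<in>Q. \<forall>\<delta>>0. \<exists>l. P l \<omega> \<inter> ball x \<delta> \<noteq> {}"
    using generation by (rule AE_hits_all_balls)
  then show "AE \<omega> in \<Omega>. \<exists>l\<^sub>0. \<forall>l\<ge>l\<^sub>0. archive_close F Q \<epsilon> \<Delta> (A l \<omega>)"
  proof (rule AE_mp, intro AE_I2 impI)
    fix \<omega> assume \<omega>: "\<omega> \<in> space \<Omega>" and dense: "\<forall>x\<in>Q. \<forall>\<delta>>0. \<exists>l. P l \<omega> \<inter> ball x \<delta> \<noteq> {}"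
    show "\<exists>l\<^sub>0. \<forall>l\<ge>l\<^sub>0. archive_close F Q \<epsilon> \<Delta> (A l \<omega>)"
    proof (rule eventually_archive_close[OF assms(1,4,5,6,7) search[OF \<omega>]])
      fix x and \<eta> :: real assume x: "x \<in> eps_pareto_set F Q \<epsilon>" "\<eta> > 0"
      show "\<exists>z\<in>Q. \<exists>\<delta>>0. \<forall>p\<in>ball z \<delta>. d_inf (F x) (F p) \<le> \<eta> \<and> (\<forall>y\<in>Q. \<not> F y + \<epsilon> \<le> F p)"
        by (rule eps_pareto_undominated_ball[OF assms(1,4,2) A3(1)]) (use A3(2) x in blast)+
    qed (use dense in blast)
  qed
next
  fix \<omega> l assume \<omega>: "\<omega> \<in> space \<Omega>"
  have inv: "archive_inv F Q \<epsilon> \<Delta> \<Delta>s (A l \<omega>)"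
    by (rule archive_inv[OF assms(5,6,7) search[OF \<omega>]])
  then show "finite (A l \<omega>)" by (simp add: archive_inv_def)
  \<comment> \<open>The value \<open>m $ i\<close> is attained at a point of \<open>Q\<close>, where
    \<open>M $ i\<close> is an upper bound.\<close>
  have "m $ i \<le> M $ i" for i using m(1)[of i] M(2)[of _ i] by auto
  with inv show "real (card (A l \<omega>)) \<le> (1 / \<Delta>s) ^ CARD('k) *
      (\<Sum>i\<in>UNIV. (\<epsilon> $ i + 2 * \<Delta> + \<Delta>s) * (\<Prod>j\<in>UNIV - {i}. M $ j - m $ j + \<Delta>s))"
    using assms(5,6,7) m(2) M(2) by (intro card_archive_le) auto
qed

end
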